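(* Let $V:[0,T]\times\mathbb{R}^d\to\mathbb{R}$ be twice continuously differentiable, and set $\sigma(t,k)=i\bigl(\frac{\partial V}{\partial k}(t,k)\bigr)$ with associated flow $\mathcal{K}$. Then $V$ satisfies the integrated equilibrium equation $$V(t,k)=\int_t^T h(s-t)\,u\bigl(\sigma(s,\mathcal{K}(s,t,k))\bigr)\,ds+h(T-t)\,g\bigl(\mathcal{K}(T,t,k)\bigr)\qquad\text{for all }(t,k)\in[0,T]\times\mathbb{R}^d$$ if and only if it satisfies the differentiated equilibrium equation $$\frac{\partial V}{\partial t}(t,k)+\int_t^T h'(s-t)\,u\bigl(\sigma(s,\mathcal{K}(s,t,k))\bigr)\,ds+h'(T-t)\,g\bigl(\mathcal{K}(T,t,k)\bigr)+\tilde u\Bigl(\frac{\partial V}{\partial k}(t,k)\Bigr)+\frac{\partial V}{\partial k}(t,k)\,f(t,k)=0$$ for all $(t,k)\in[0,T]\times\mathbb{R}^d$, together with the boundary condition $V(T,k)=g(k)$ for all $k\in\mathbb{R}^d$.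
   Context: $T>0$ is finite and $d\ge1$. The discount function $h:[0,\infty)\to\mathbb{R}$ is continuously differentiable with $h(0)=1$, $h\ge 0$, $h'\le 0$ and $h(t)\to0$ as $t\to\infty$. The functions $u:\mathbb{R}^d\to\mathbb{R}$, $f:[0,T]\times\mathbb{R}^d\to\mathbb{R}^d$ and $g:\mathbb{R}^d\to\mathbb{R}$ are twice continuously differentiable; $u$ is strictly concave and $f(t,k)$ is strictly concave with respect to $k$. The gradient $u':\mathbb{R}^d\to\mathbb{R}^d$ has a continuously differentiable inverse $i:\mathbb{R}^d\to\mathbb{R}^d$. The Legendre–Fenchel transform of $u$ is $\tilde u(x)=\max_{c\in\mathbb{R}^d}(u(c)-x\cdot c)=u(i(x))-x\cdot i(x)$. The product $\frac{\partial V}{\partial k}f$ is the scalar product of the gradient with $f$. The flow $\mathcal{K}(s,t,k)$ associated with a strategy $\sigma$ is the value at time $s$ of the solution of $\frac{dk}{ds}=f(s,k(s))-\sigma(s,k(s))$ which takes the value $k$ at time $t$; solutions are taken to exist on the whole of $[t,T]$. *)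

theory Defs
  imports "HOL-Analysis.Analysis"
begin

text \<open>
  The sets \<open>S\<close> used here may have boundary points, such as \<open>[0,T] \<times> \<real>\<^sup>d\<close>; there the derivative is
  the derivative relative to \<open>S\<close> (one-sided in time). It is unique because \<open>S\<close> is convex with
  nonempty interior. Continuity of the derivative is with respect to the operator norm.
\<close>

definition C1_on :: "'a::real_normed_vector set \<Rightarrow> ('a \<Rightarrow> 'b::real_normed_vector) \<Rightarrow> bool" where
  "C1_on S F \<longleftrightarrow> (\<exists>F' :: 'a \<Rightarrow> 'a \<Rightarrow>\<^sub>L 'b.
     (\<forall>x\<in>S. (F has_derivative blinfun_apply (F' x)) (at x within S)) \<and> continuous_on S F')"

definition C2_on :: "'a::real_normed_vector set \<Rightarrow> ('a \<Rightarrow> 'b::real_normed_vector) \<Rightarrow> bool" where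
  "C2_on S F \<longleftrightarrow> (\<exists>F' :: 'a \<Rightarrow> 'a \<Rightarrow>\<^sub>L 'b.
     (\<forall>x\<in>S. (F has_derivative blinfun_apply (F' x)) (at x within S)) \<and> C1_on S F')"

definition strictly_concave :: "('a::real_vector \<Rightarrow> real) \<Rightarrow> bool" where
  "strictly_concave F \<longleftrightarrow> (\<forall>x y. \<forall>a::real. x \<noteq> y \<longrightarrow> 0 < a \<longrightarrow> a < 1 \<longrightarrow>
     (1 - a) * F x + a * F y < F ((1 - a) *\<^sub>R x + a *\<^sub>R y))"

definition gradient :: "('a::real_inner \<Rightarrow> real) \<Rightarrow> 'a \<Rightarrow> 'a" where
  "gradient F x = (THE D. GDERIV F x :> D)"

definition legendre_fenchel :: "('a::real_inner \<Rightarrow> real) \<Rightarrow> 'a \<Rightarrow> real" where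
  "legendre_fenchel u x = (GREATEST y. \<exists>c. y = u c - inner x c)"

text \<open>
  \<open>K s t k\<close> is the value at time \<open>s\<close> of the solution starting at time \<open>t\<close> in state \<open>k\<close>; it is
  constrained only for \<open>0 \<le> t \<le> s \<le> T\<close>. That \<open>K\<close> satisfies this predicate includes that
  solutions exist on the whole of \<open>[t,T]\<close>.
\<close>

definition is_flow ::
  "real \<Rightarrow> (real \<Rightarrow> 'a \<Rightarrow> 'a::real_normed_vector) \<Rightarrow> (real \<Rightarrow> real \<Rightarrow> 'a \<Rightarrow> 'a) \<Rightarrow> bool" where
  "is_flow T F K \<longleftrightarrow> (\<forall>t\<in>{0..T}. \<forall>k. K t t k = k \<and>
     (\<forall>s\<in>{t..T}. ((\<lambda>r. K r t k) has_vector_derivative F s (K s t k)) (at s within {t..T})))"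

end

theory Submission
  imports Defs
begin

text \<open>
  For a path \<open>x(r) = K r t k\<close> of the flow, let \<open>D(t,k)\<close> be the difference of the two sides of the
  integrated equation and \<open>E(t,k)\<close> the left-hand side of the differentiated equation. Everything
  rests on the identity
    \<open>d/dr D(r, x(r)) = E(r, x(r))\<close> for \<open>r \<in> [t,T]\<close>
  (lemma \<open>integrated_defect_has_derivative_along_flow\<close>). Indeed the path that starts at \<open>(r, x(r))\<close>
  is the rest of the path that starts at \<open>(t,k)\<close>, so that
    \<open>D(r, x(r)) = V(r, x(r)) - \<integral>\<^sub>r\<^sup>T h(s-r) w(s) ds - h(T-r) g(x(T))\<close>
  with \<open>w(s) = u(\<sigma>(s, x(s)))\<close> and \<open>x(T)\<close> independent of \<open>r\<close>. Differentiating in \<open>r\<close> gives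
  the terms with \<open>h'\<close>, the term \<open>w(r)\<close> from the lower limit (as \<open>h(0) = 1\<close>), and the
  derivative of \<open>V\<close> along \<open>f - \<sigma>\<close>; by concavity of \<open>u\<close>,
  \<open>u(\<sigma>) - \<nabla>V \<bullet> \<sigma>\<close> is the Legendre-Fenchel transform at \<open>\<nabla>V\<close>.

  If \<open>E\<close> vanishes, \<open>D\<close> is constant along every path, with end value \<open>V(T,x(T)) - g(x(T)) = 0\<close>.
  If \<open>D\<close> vanishes, the derivative at \<open>r = t\<close> yields \<open>E(t,k) = 0\<close> for \<open>t < T\<close>. At \<open>t = T\<close> the path
  is a single point and carries no derivative; there \<open>E(T,k) = 0\<close> follows from
  \<open>E(r,k) \<rightarrow> E(T,k)\<close> as \<open>r \<rightarrow> T\<close> (lemma \<open>differentiated_defect_tendsto_terminal\<close>), which needs that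
  paths starting in \<open>k\<close> stay near \<open>k\<close> for a short time, uniformly in the starting time.

  The restart property of the flow is uniqueness of solutions: the velocity
  \<open>f - i(\<nabla>V)\<close> is continuously differentiable, hence Lipschitz on compact convex sets.
\<close>

section \<open>Continuously differentiable functions\<close>

lemma C1_on_imp_continuous_on:
  assumes "C1_on S F"
  shows "continuous_on S F"
proof -
  obtain F' where "\<forall>x\<in>S. (F has_derivative blinfun_apply (F' x)) (at x within S)"
    using assms unfolding C1_on_def by blast
  then show ?thesis
    by (intro has_derivative_continuous_on[where f' = "\<lambda>x. blinfun_apply (F' x)"]) auto
qed

lemma C2_on_imp_C1_on:
  assumes "C2_on S F"
  shows "C1_on S F"
proof -
  obtain F' where F': "\<forall>x\<in>S. (F has_derivative blinfun_apply (F' x)) (at x within S)"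
    and "C1_on S F'"
    using assms unfolding C2_on_def by blast
  with C1_on_imp_continuous_on show ?thesis unfolding C1_on_def[of S F] by blast
qed

lemma C1_on_cong:
  assumes "C1_on S F" "\<And>x. x \<in> S \<Longrightarrow> F x = G x"
  shows "C1_on S G"
  using assms has_derivative_transform unfolding C1_on_def by metis

lemma C1_on_bounded_linear:
  assumes "bounded_linear L"
  shows "C1_on S L"
  unfolding C1_on_def
  using assms bounded_linear_imp_has_derivative
  by (intro exI[of _ "\<lambda>_. Blinfun L"])
     (auto simp: bounded_linear_Blinfun_apply bounded_linear.has_derivative)

lemma C1_on_diff:
  assumes "C1_on S F" "C1_on S G"
  shows "C1_on S (\<lambda>x. F x - G x)"
proof -
  obtain F' G' where
    "\<forall>x\<in>S. (F has_derivative blinfun_apply (F' x)) (at x within S)" "continuous_on S F'"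
    "\<forall>x\<in>S. (G has_derivative blinfun_apply (G' x)) (at x within S)" "continuous_on S G'"
    using assms unfolding C1_on_def by blast
  then show ?thesis
    unfolding C1_on_def
    by (intro exI[of _ "\<lambda>x. F' x - G' x"])
       (auto simp: minus_blinfun.rep_eq intro!: has_derivative_diff continuous_intros)
qed

lemma C1_on_compose:
  assumes "C1_on T G" "C1_on S F" "F ` S \<subseteq> T"
  shows "C1_on S (\<lambda>x. G (F x))"
proof -
  obtain F' G' where
    F: "\<forall>x\<in>S. (F has_derivative blinfun_apply (F' x)) (at x within S)" "continuous_on S F'" and
    G: "\<forall>x\<in>T. (G has_derivative blinfun_apply (G' x)) (at x within T)" "continuous_on T G'"
    using assms unfolding C1_on_def by blast
  have "((\<lambda>x. G (F x)) has_derivative blinfun_apply (G' (F x) o\<^sub>L F' x)) (at x within S)"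
    if "x \<in> S" for x
    using has_derivative_in_compose2[of T G "\<lambda>x. blinfun_apply (G' x)" F S x "blinfun_apply (F' x)"]
      F G that assms(3) by (simp add: blinfun_compose.rep_eq comp_def)
  moreover have "continuous_on S (\<lambda>x. G' (F x) o\<^sub>L F' x)"
    using F(2) G(2) assms(3) C1_on_imp_continuous_on[OF assms(2)]
    by (auto intro!: continuous_intros intro: continuous_on_compose2)
  ultimately show ?thesis unfolding C1_on_def by (intro exI[of _ "\<lambda>x. G' (F x) o\<^sub>L F' x"]) auto
qed

lemma C1_on_imp_lipschitz_on_compact_convex:
  assumes "C1_on S F" "compact A" "convex A" "A \<subseteq> S"
  obtains M where "M \<ge> 0" "\<And>x y. x \<in> A \<Longrightarrow> y \<in> A \<Longrightarrow> norm (F x - F y) \<le> M * norm (x - y)"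
proof -
  obtain F' where
    F: "\<forall>x\<in>S. (F has_derivative blinfun_apply (F' x)) (at x within S)" "continuous_on S F'"
    using assms unfolding C1_on_def by blast
  have "compact (F' ` A)"
    using F(2) assms by (meson compact_continuous_image continuous_on_subset)
  from compact_imp_bounded[OF this]
  obtain M where M: "M > 0" "\<And>x. x \<in> A \<Longrightarrow> norm (F' x) \<le> M"
    unfolding bounded_pos by auto
  have "norm (F x - F y) \<le> M * norm (x - y)" if "x \<in> A" "y \<in> A" for x y
    using that assms F M
    by (intro differentiable_bound[where S = A and f' = "\<lambda>x. blinfun_apply (F' x)"])
       (auto simp: norm_blinfun.rep_eq[symmetric] intro: has_derivative_subset)
  with M show ?thesis using that by (meson less_imp_le)
qed

lemma C1_on_subset:
  assumes "C1_on S F" "T \<subseteq> S"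
  shows "C1_on T F"
proof -
  obtain F' where
    F: "\<forall>x\<in>S. (F has_derivative blinfun_apply (F' x)) (at x within S)" "continuous_on S F'"
    using assms unfolding C1_on_def by blast
  then have "\<forall>x\<in>T. (F has_derivative blinfun_apply (F' x)) (at x within T)"
    using assms(2) by (auto intro: has_derivative_subset)
  moreover have "continuous_on T F'" using F(2) assms(2) by (rule continuous_on_subset)
  ultimately show ?thesis unfolding C1_on_def by blast
qed

section \<open>Gradients and the Legendre-Fenchel transform\<close>

lemma gradient_eq_GDERIV: "GDERIV f x :> D \<Longrightarrow> gradient f x = D"
  unfolding gradient_def
proof (rule the_equality)
  fix E assume "GDERIV f x :> D" "GDERIV f x :> E"
  then have "inner y E = inner y D" for y
    unfolding gderiv_def by (metis has_derivative_unique)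
  then show "E = D" by (metis inner_commute vector_eq_rdot)
qed

lemma gradient_eq_sum_Basis:
  fixes f :: "'a::euclidean_space \<Rightarrow> real"
  assumes "(f has_derivative L) (at x)"
  shows "gradient f x = (\<Sum>b\<in>Basis. L b *\<^sub>R b)" "inner (gradient f x) w = L w"
proof -
  interpret L: bounded_linear L using assms by (rule has_derivative_bounded_linear)
  have L: "L w = inner w (\<Sum>b\<in>Basis. L b *\<^sub>R b)" for w
  proof -
    have "L w = L (\<Sum>b\<in>Basis. inner w b *\<^sub>R b)" by (simp add: euclidean_representation)
    also have "\<dots> = inner w (\<Sum>b\<in>Basis. L b *\<^sub>R b)"
      by (simp add: L.sum L.scaleR inner_sum_right mult.commute)
    finally show ?thesis .
  qed
  have "GDERIV f x :> (\<Sum>b\<in>Basis. L b *\<^sub>R b)"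
    unfolding gderiv_def using assms by (rule has_derivative_eq_rhs) (rule ext, rule L)
  then show *: "gradient f x = (\<Sum>b\<in>Basis. L b *\<^sub>R b)" by (rule gradient_eq_GDERIV)
  show "inner (gradient f x) w = L w" unfolding * by (subst inner_commute, subst L) (rule refl)
qed

text \<open>
  Proved by restricting \<open>u\<close> to the line through \<open>c\<close> and \<open>y\<close>, where the one-dimensional result
  applies.
\<close>

lemma strictly_concave_below_tangent:
  fixes u :: "'a::euclidean_space \<Rightarrow> real"
  assumes "strictly_concave u" "(u has_derivative L) (at c)"
  shows "u y \<le> u c + inner (gradient u c) (y - c)"
proof -
  define p where "p a = - u (c + a *\<^sub>R (y - c))" for a :: real
  have "convex_on UNIV p"
  proof (rule convex_onI)
    fix a b e :: real assume a: "0 < e" "e < 1"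
    show "p ((1 - e) *\<^sub>R a + e *\<^sub>R b) \<le> (1 - e) * p a + e * p b"
    proof (cases "c + a *\<^sub>R (y - c) = c + b *\<^sub>R (y - c)")
      case True
      then have "a = b \<or> y = c" by auto
      then show ?thesis by (auto simp: p_def algebra_simps)
    next
      case False
      have *: "c + ((1 - e) * a + e * b) *\<^sub>R (y - c)
          = (1 - e) *\<^sub>R (c + a *\<^sub>R (y - c)) + e *\<^sub>R (c + b *\<^sub>R (y - c))"
        by (simp add: algebra_simps)
      have "(1 - e) * u (c + a *\<^sub>R (y - c)) + e * u (c + b *\<^sub>R (y - c))
          < u ((1 - e) *\<^sub>R (c + a *\<^sub>R (y - c)) + e *\<^sub>R (c + b *\<^sub>R (y - c)))"
        using assms(1) False a unfolding strictly_concave_def by blast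
      then show ?thesis unfolding p_def real_scaleR_def * by simp
    qed
  qed simp
  moreover have "(p has_real_derivative - L (y - c)) (at 0 within UNIV)"
  proof -
    interpret L: bounded_linear L using assms(2) by (rule has_derivative_bounded_linear)
    have "((\<lambda>a. c + a *\<^sub>R (y - c)) has_derivative (\<lambda>a. a *\<^sub>R (y - c))) (at (0::real))"
      by (auto intro!: derivative_eq_intros)
    from has_derivative_compose[OF this, of u L] assms(2)
    have "((\<lambda>a. u (c + a *\<^sub>R (y - c))) has_derivative (\<lambda>a. L (a *\<^sub>R (y - c)))) (at (0::real))"
      by simp
    from has_derivative_minus[OF this] show ?thesis
      unfolding has_field_derivative_def p_def
      by (rule has_derivative_eq_rhs) (auto simp: L.scaleR mult.commute)
  qed
  ultimately have "p 1 - p 0 \<ge> - L (y - c) * (1 - 0)"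
    by (intro convex_on_imp_above_tangent[where A = UNIV]) auto
  then show ?thesis using gradient_eq_sum_Basis(2)[OF assms(2)] by (simp add: p_def)
qed

lemma legendre_fenchel_eq:
  fixes u :: "'a::euclidean_space \<Rightarrow> real"
  assumes "strictly_concave u" "(u has_derivative L) (at c)"
  shows "legendre_fenchel u (gradient u c) = u c - inner (gradient u c) c"
  unfolding legendre_fenchel_def
proof (rule Greatest_equality)
  fix z assume "\<exists>y. z = u y - inner (gradient u c) y"
  then obtain y where "z = u y - inner (gradient u c) y" ..
  then show "z \<le> u c - inner (gradient u c) c"
    using strictly_concave_below_tangent[OF assms, of y] by (simp add: inner_diff_right)
qed blast

section \<open>Uniqueness and short-time behaviour of flows\<close>

text \<open>
  Both solutions stay in a ball, on which \<open>F\<close> has a Lipschitz constant \<open>M\<close>. The weighted squared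
  distance \<open>|x - y|\<^sup>2 exp(-2Ms)\<close> then does not increase, and it starts from zero.
\<close>

lemma ode_unique:
  fixes F :: "real \<Rightarrow> 'a::euclidean_space \<Rightarrow> 'a"
  assumes F: "C1_on ({a..b} \<times> UNIV) (\<lambda>(t, k). F t k)"
    and x: "\<And>s. s \<in> {a..b} \<Longrightarrow> (x has_vector_derivative F s (x s)) (at s within {a..b})"
    and y: "\<And>s. s \<in> {a..b} \<Longrightarrow> (y has_vector_derivative F s (y s)) (at s within {a..b})"
    and eq: "x a = y a" and c: "c \<in> {a..b}"
  shows "x c = y c"
proof -
  have cx: "continuous_on {a..b} x" and cy: "continuous_on {a..b} y"
    by (rule continuous_on_vector_derivative, erule x, rule continuous_on_vector_derivative, erule y)
  have "compact (x ` {a..b} \<union> y ` {a..b})"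
    using cx cy by (simp add: compact_continuous_image compact_Un)
  from compact_imp_bounded[OF this]
  obtain R where R: "\<And>z. z \<in> x ` {a..b} \<union> y ` {a..b} \<Longrightarrow> norm z \<le> R"
    unfolding bounded_iff by auto
  obtain M where M: "\<And>p q. p \<in> {a..b} \<times> cball 0 R \<Longrightarrow> q \<in> {a..b} \<times> cball 0 R \<Longrightarrow>
      norm ((\<lambda>(t, k). F t k) p - (\<lambda>(t, k). F t k) q) \<le> M * norm (p - q)"
    by (rule C1_on_imp_lipschitz_on_compact_convex[OF F, of "{a..b} \<times> cball 0 R"])
       (auto intro: compact_Times convex_Times)
  have lip: "norm (F s (x s) - F s (y s)) \<le> M * norm (x s - y s)" if "s \<in> {a..b}" for s
    using M[of "(s, x s)" "(s, y s)"] R that by (simp add: norm_Pair)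
  define p where "p s = inner (x s - y s) (x s - y s) * exp (- (2 * M * s))" for s
  have "p c \<le> p a"
  proof (rule DERIV_nonpos_imp_decreasing_open[where f = p and a = a and b = c])
    show "a \<le> c" using c by simp
    show "continuous_on {a..c} p"
      unfolding p_def using c cx cy
      by (auto intro!: continuous_intros intro: continuous_on_subset)
    fix s assume s: "a < s" "s < c"
    then have at: "at s within {a..b} = at s" using c by (simp add: at_within_Icc_at)
    have d: "(x has_vector_derivative F s (x s)) (at s)" "(y has_vector_derivative F s (y s)) (at s)"
      using x[of s] y[of s] s c at by auto
    let ?z = "x s - y s" and ?w = "F s (x s) - F s (y s)"
    have "((\<lambda>s. inner (x s - y s) (x s - y s)) has_derivative
        (\<lambda>h. inner ?z (h *\<^sub>R ?w) + inner (h *\<^sub>R ?w) ?z)) (at s)"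
      using d unfolding has_vector_derivative_def
      by (auto intro!: derivative_eq_intros simp: scaleR_diff_right)
    then have "((\<lambda>s. inner (x s - y s) (x s - y s)) has_real_derivative 2 * inner ?z ?w) (at s)"
      unfolding has_field_derivative_def
      by (rule has_derivative_eq_rhs) (auto simp: inner_commute)
    moreover have "((\<lambda>s. exp (- (2 * M * s))) has_real_derivative
        - 2 * M * exp (- (2 * M * s))) (at s)"
      by (auto intro!: derivative_eq_intros)
    ultimately have "DERIV p s :> 2 * inner ?z ?w * exp (- (2 * M * s))
        + - 2 * M * exp (- (2 * M * s)) * inner ?z ?z"
      unfolding p_def by (rule DERIV_mult)
    then have "DERIV p s :> (2 * inner ?z ?w - 2 * M * inner ?z ?z) * exp (- (2 * M * s))"
      by (rule DERIV_cong) algebra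
    moreover have "inner ?z ?w \<le> M * inner ?z ?z"
    proof -
      have "inner ?z ?w \<le> norm ?z * norm ?w" by (rule norm_cauchy_schwarz)
      also have "\<dots> \<le> norm ?z * (M * norm ?z)" using lip[of s] s c by (intro mult_left_mono) auto
      finally show ?thesis by (simp add: power2_norm_eq_inner[symmetric] power2_eq_square ac_simps)
    qed
    ultimately show "\<exists>y. DERIV p s :> y \<and> y \<le> 0"
      by (intro exI conjI) (auto simp: mult_nonpos_nonneg)
  qed
  then have "inner (x c - y c) (x c - y c) * exp (- (2 * M * c)) \<le> 0"
    by (simp add: p_def eq)
  then have "inner (x c - y c) (x c - y c) \<le> 0" by (simp add: mult_le_0_iff)
  then show ?thesis by (metis inner_gt_zero_iff not_less right_minus_eq)
qed

lemma is_flow_semigroup: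
  fixes F :: "real \<Rightarrow> 'a::euclidean_space \<Rightarrow> 'a"
  assumes K: "is_flow T F K" and F: "C1_on ({0..T} \<times> UNIV) (\<lambda>(t, k). F t k)"
    and r: "0 \<le> t" "t \<le> r" "r \<le> s" "s \<le> T"
  shows "K s r (K r t k) = K s t k"
proof (rule ode_unique[where a = r and b = T and F = F
      and x = "\<lambda>s. K s r (K r t k)" and y = "\<lambda>s. K s t k"])
  show "C1_on ({r..T} \<times> UNIV) (\<lambda>(t, k). F t k)"
    by (rule C1_on_subset[OF F]) (use r in auto)
  show "((\<lambda>s. K s r (K r t k)) has_vector_derivative F q (K q r (K r t k))) (at q within {r..T})"
    if "q \<in> {r..T}" for q
    using K r that unfolding is_flow_def by auto
  show "((\<lambda>s. K s t k) has_vector_derivative F q (K q t k)) (at q within {r..T})"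
    if "q \<in> {r..T}" for q
    by (rule has_vector_derivative_within_subset[where S = "{t..T}"])
       (use K r that in \<open>auto simp: is_flow_def\<close>)
  show "K r r (K r t k) = K r t k" using K r unfolding is_flow_def by auto
  show "s \<in> {r..T}" using r by auto
qed

text \<open>
  The \<open>\<delta>\<close> depends on the state \<open>k\<close> but not on the starting time \<open>r\<close>. With \<open>M\<close> a bound for the
  speed on the ball of radius \<open>e\<close>, a path cannot leave the ball before the time \<open>e / M\<close>.
\<close>

lemma is_flow_short_time:
  fixes F :: "real \<Rightarrow> 'a::euclidean_space \<Rightarrow> 'a"
  assumes K: "is_flow T F K" and F: "continuous_on ({0..T} \<times> UNIV) (\<lambda>(t, k). F t k)"
    and e: "e > 0"
  obtains \<delta> where "\<delta> > 0"
    "\<And>r s. 0 \<le> r \<Longrightarrow> r \<le> s \<Longrightarrow> s \<le> T \<Longrightarrow> s - r < \<delta> \<Longrightarrow> dist (K s r k) k < e"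
proof -
  have "compact ((\<lambda>(t, k). F t k) ` ({0..T} \<times> cball k e))"
    using F by (intro compact_continuous_image continuous_on_subset[OF F] compact_Times) auto
  from compact_imp_bounded[OF this]
  obtain M where "M > 0"
    and "\<forall>z \<in> (\<lambda>(t, k). F t k) ` ({0..T} \<times> cball k e). norm z \<le> M"
    unfolding bounded_pos by auto
  then have M: "norm (F q z) \<le> M" if "q \<in> {0..T}" "dist z k \<le> e" for q z
    using that by (auto simp: dist_commute)
  have "dist (K s r k) k < e" if rs: "0 \<le> r" "r \<le> s" "s \<le> T" "s - r < e / M" for r s
  proof (rule ccontr)
    assume "\<not> dist (K s r k) k < e"
    have d: "((\<lambda>q. K q r k) has_vector_derivative F q (K q r k)) (at q within {r..T})"
      if "q \<in> {r..T}" for q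
      using K rs that unfolding is_flow_def by auto
    then have cK: "continuous_on {r..T} (\<lambda>q. K q r k)"
      by (intro continuous_on_vector_derivative) auto
    have Krr: "K r r k = k" using K rs unfolding is_flow_def by auto
    \<comment> \<open>The first exit time \<open>q\<close>: before it, the bound \<open>M\<close> for the speed applies.\<close>
    define A where "A = {q \<in> {r..s}. e \<le> dist (K q r k) k}"
    have "closed A"
      unfolding A_def
      by (intro continuous_on_closed_Collect_le continuous_intros continuous_on_subset[OF cK])
         (use rs in auto)
    moreover have "bounded A" by (rule bounded_subset[of "{r..s}"]) (auto simp: A_def)
    ultimately have "compact A" by (simp add: compact_eq_bounded_closed)
    moreover have "s \<in> A" using rs \<open>\<not> dist (K s r k) k < e\<close> by (auto simp: A_def)
    ultimately obtain q where q: "q \<in> A" and min: "\<And>p. p \<in> A \<Longrightarrow> q \<le> p"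
      using compact_attains_inf[of A] by blast
    have "q \<noteq> r" using q Krr e by (auto simp: A_def)
    then have rq: "r < q" "q \<le> s" using q by (auto simp: A_def)
    have "norm (K q r k - K r r k) \<le> M * q - M * r"
    proof (rule differentiable_bound_general[where f' = "\<lambda>q. F q (K q r k)" and \<phi>' = "\<lambda>_. M"])
      show "r < q" by fact
      show "continuous_on {r..q} (\<lambda>q. K q r k)"
        using cK rq rs by (auto intro: continuous_on_subset)
      show "continuous_on {r..q} (\<lambda>q. M * q)" by (intro continuous_intros)
      fix p assume p: "r < p" "p < q"
      show "((\<lambda>q. K q r k) has_vector_derivative F p (K p r k)) (at p)"
        using d[of p] p rq rs by (simp add: at_within_Icc_at)
      show "((\<lambda>q. M * q) has_vector_derivative M) (at p)"
        unfolding has_real_derivative_iff_has_vector_derivative[symmetric]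
        by (auto intro!: derivative_eq_intros)
      have "p \<notin> A" using min p by force
      then show "norm (F p (K p r k)) \<le> M" using p rq rs by (intro M) (auto simp: A_def)
    qed
    also have "\<dots> \<le> M * (s - r)" using rq \<open>M > 0\<close> by (simp add: algebra_simps)
    also have "\<dots> < e" using rs(4) \<open>M > 0\<close> by (simp add: field_simps)
    finally show False using q Krr by (simp add: A_def dist_norm)
  qed
  then show ?thesis using e \<open>M > 0\<close> by (intro that[of "e / M"]) auto
qed

section \<open>Differentiating the discounted integral\<close>

text \<open>
  The discount function has only a one-sided derivative at \<open>0\<close>. Extending it by its tangent to the
  negative numbers makes it continuously differentiable on the whole line.
\<close>

lemma extend_discount:
  fixes h h' :: "real \<Rightarrow> real"
  assumes h: "\<And>t. t \<ge> 0 \<Longrightarrow> (h has_real_derivative h' t) (at t within {0..})"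
  shows "((\<lambda>t. if t \<in> {0..} then h t else h 0 + h' 0 * t) has_real_derivative h' (max 0 x)) (at x)"
proof -
  have "((\<lambda>t. if t \<in> {0..} then h t else h 0 + h' 0 * t) has_vector_derivative
      (if x \<in> {0..} then h' x else h' 0)) (at x within UNIV)"
  proof (rule has_vector_derivative_If_within_closures[where T = "{..0}"])
    assume "x \<in> {0..} \<union> closure {0..} \<inter> closure {..0}"
    moreover have "{0..} \<union> closure {0..} \<inter> closure {..0} = {0::real..}" by auto
    ultimately show "(h has_vector_derivative h' x)
        (at x within {0..} \<union> closure {0..} \<inter> closure {..0})"
      using h[of x] by (simp add: has_real_derivative_iff_has_vector_derivative)
  next
    show "((\<lambda>t. h 0 + h' 0 * t) has_vector_derivative h' 0)
        (at x within {..0} \<union> closure {0..} \<inter> closure {..0})"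
      unfolding has_real_derivative_iff_has_vector_derivative[symmetric]
      by (auto intro!: derivative_eq_intros)
  qed auto
  then show ?thesis
    by (auto simp: has_real_derivative_iff_has_vector_derivative max_def split: if_splits)
qed

text \<open>
  The variable \<open>r\<close> occurs in the limit and in the integrand. The integral is the restriction
  to the diagonal of a function of two variables, which is differentiable because its partial
  derivatives exist and the one for the limit is jointly continuous.
\<close>

lemma discounted_integral_has_derivative:
  fixes h h' w :: "real \<Rightarrow> real"
  assumes h: "\<And>t. t \<ge> 0 \<Longrightarrow> (h has_real_derivative h' t) (at t within {0..})"
    and h': "continuous_on {0..} h'"
    and w: "continuous_on {t..T} w" and r: "r \<in> {t..T}"
  shows "((\<lambda>r. integral {r..T} (\<lambda>s. h (s - r) * w s)) has_real_derivative
      - (h 0 * w r + integral {r..T} (\<lambda>s. h' (s - r) * w s))) (at r within {t..T})"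
proof -
  define H where "H = (\<lambda>t. if t \<in> {0..} then h t else h 0 + h' 0 * t)"
  define H' where "H' = (\<lambda>t. h' (max 0 t))"
  have H: "(H has_real_derivative H' x) (at x within A)" for x A
    unfolding H_def H'_def using extend_discount[OF h] by (rule DERIV_subset) auto
  have cH: "continuous_on UNIV H" using H by (rule DERIV_continuous_on)
  have cH': "continuous_on UNIV H'"
    unfolding H'_def
    by (rule continuous_on_compose2[OF h']) (auto intro!: continuous_intros)
  let ?I = "{t..T}"
  \<comment> \<open>For \<open>y < x\<close>, \<open>H\<close> is evaluated at negative arguments; on the diagonal it agrees with \<open>h\<close>.\<close>
  define J where "J x y = integral {y..T} (\<lambda>s. H (s - x) * w s)" for x y
  let ?fx = "\<lambda>z. z * - integral {r..T} (\<lambda>s. H' (s - r) * w s)"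
  let ?fy = "\<lambda>x y. blinfun_mult_right (- (H (y - x) * w y))"
  have "((\<lambda>(x, y). J x y) has_derivative (\<lambda>(tx, ty). ?fx tx + blinfun_apply (?fy r r) ty))
      (at (r, r) within ?I \<times> ?I)"
  proof (rule has_derivative_partialsI[where fy = ?fy])
    have "((\<lambda>x. integral (cbox r T) (\<lambda>s. H (s - x) * w s)) has_real_derivative
        integral (cbox r T) (\<lambda>s. - H' (s - r) * w s)) (at r within ?I)"
    proof (rule leibniz_rule_field_derivative)
      show "((\<lambda>x. H (s - x) * w s) has_real_derivative - H' (s - x) * w s) (at x within ?I)" for x s
        by (auto intro!: derivative_eq_intros DERIV_chain'[where g = H, OF _ H])
      show "(\<lambda>s. H (s - x) * w s) integrable_on cbox r T" for x
        using r unfolding cbox_interval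
        by (intro integrable_continuous_real continuous_intros continuous_on_compose2[OF cH]
            continuous_on_subset[OF w]) auto
      show "continuous_on (?I \<times> cbox r T) (\<lambda>(x, s). - H' (s - x) * w s)"
        using r unfolding split_beta cbox_interval
        by (intro continuous_intros continuous_on_compose2[OF cH'] continuous_on_compose2[OF w]) auto
    qed (use r in auto)
    then show "((\<lambda>x. J x r) has_derivative ?fx) (at r within ?I)"
      unfolding has_field_derivative_def J_def cbox_interval
      by (rule has_derivative_eq_rhs) (auto simp: mult.commute)
    show "((\<lambda>y. J x y) has_derivative blinfun_apply (?fy x y)) (at y within ?I)"
      if "x \<in> ?I" "y \<in> ?I" for x y
    proof -
      have "((\<lambda>y. J x y) has_real_derivative - (H (y - x) * w y)) (at y within ?I)"
        unfolding J_def
        by (rule integral_has_real_derivative'[OF _ that(2)])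
           (use w in \<open>auto intro!: continuous_intros continuous_on_compose2[OF cH]\<close>)
      then show ?thesis by (simp add: has_field_derivative_def mult.commute)
    qed
    have "continuous_on (?I \<times> ?I) (\<lambda>(x, y). ?fy x y)"
      unfolding split_beta
      by (intro continuous_intros bounded_linear.continuous_on[OF bounded_linear_blinfun_mult_right]
          continuous_on_compose2[OF cH] continuous_on_compose2[OF w]) auto
    then show "continuous (at (r, r) within ?I \<times> ?I) (\<lambda>(x, y). ?fy x y)"
      using r by (auto simp: continuous_on_eq_continuous_within)
  qed (use r in auto)
  then have "((\<lambda>(x, y). J x y) has_derivative (\<lambda>(tx, ty). ?fx tx + blinfun_apply (?fy r r) ty))
      (at (r, r) within (\<lambda>r. (r, r)) ` ?I)"
    by (rule has_derivative_subset) auto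
  moreover have "((\<lambda>r. (r, r)) has_derivative (\<lambda>z. (z, z))) (at r within ?I)"
    by (intro has_derivative_Pair has_derivative_ident)
  ultimately have "((\<lambda>r. J r r) has_derivative (\<lambda>z. ?fx z + blinfun_apply (?fy r r) z))
      (at r within ?I)"
    using has_derivative_in_compose[of "\<lambda>r. (r, r)" "\<lambda>z. (z, z)" r ?I "\<lambda>(x, y). J x y"]
    by fastforce
  moreover have "H 0 = h 0" by (simp add: H_def)
  moreover have "integral {r..T} (\<lambda>s. H' (s - r) * w s) = integral {r..T} (\<lambda>s. h' (s - r) * w s)"
    by (rule integral_cong) (auto simp: H'_def max_def)
  ultimately have "((\<lambda>r. J r r) has_real_derivative
      - (h 0 * w r + integral {r..T} (\<lambda>s. h' (s - r) * w s))) (at r within ?I)"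
    unfolding has_field_derivative_def
    by (auto elim!: has_derivative_eq_rhs simp: algebra_simps)
  moreover have "J x x = integral {x..T} (\<lambda>s. h (s - x) * w s)" for x
    unfolding J_def by (rule integral_cong) (auto simp: H_def)
  ultimately show ?thesis by simp
qed

section \<open>Partial derivatives of a function of time and state\<close>

lemma gradient_slice:
  fixes V :: "real \<Rightarrow> 'a::euclidean_space \<Rightarrow> real"
  assumes V: "((\<lambda>(t, k). V t k) has_derivative L) (at (t, k) within A \<times> UNIV)" and t: "t \<in> A"
  shows "gradient (V t) k = (\<Sum>b\<in>Basis. L (0, b) *\<^sub>R b)"
    and "inner (gradient (V t) k) w = L (0, w)"
proof -
  have "((\<lambda>(t, k). V t k) has_derivative L) (at (t, k) within Pair t ` UNIV)"
    using V by (rule has_derivative_subset) (use t in auto)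
  moreover have "(Pair t has_derivative Pair 0) (at k)"
    by (intro has_derivative_Pair has_derivative_ident has_derivative_const)
  ultimately have "(V t has_derivative (\<lambda>w. L (0, w))) (at k)"
    using has_derivative_in_compose[of "Pair t" "Pair 0" k UNIV "\<lambda>(t, k). V t k" L] by simp
  then show "gradient (V t) k = (\<Sum>b\<in>Basis. L (0, b) *\<^sub>R b)"
    and "inner (gradient (V t) k) w = L (0, w)"
    by (rule gradient_eq_sum_Basis)+
qed

lemma time_derivative_slice:
  fixes V :: "real \<Rightarrow> 'a::real_normed_vector \<Rightarrow> real"
  assumes V: "((\<lambda>(t, k). V t k) has_derivative L) (at (t, k) within {a..b} \<times> UNIV)"
    and t: "t \<in> {a..b}" "a < b"
  shows "vector_derivative (\<lambda>r. V r k) (at t within {a..b}) = L (1, 0)"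
proof -
  interpret L: bounded_linear L using V by (rule has_derivative_bounded_linear)
  have "((\<lambda>(t, k). V t k) has_derivative L) (at (t, k) within (\<lambda>r. (r, k)) ` {a..b})"
    using V by (rule has_derivative_subset) auto
  moreover have "((\<lambda>r. (r, k)) has_derivative (\<lambda>z. (z, 0))) (at t within {a..b})"
    by (intro has_derivative_Pair has_derivative_ident has_derivative_const)
  ultimately have "((\<lambda>r. V r k) has_derivative (\<lambda>z. L (z, 0))) (at t within {a..b})"
    using has_derivative_in_compose[of "\<lambda>r. (r, k)" "\<lambda>z. (z, 0)" t "{a..b}" "\<lambda>(t, k). V t k" L]
    by simp
  moreover have "L (z, 0) = z *\<^sub>R L (1, 0)" for z
    using L.scaleR[of z "(1, 0)"] by simp
  ultimately have "((\<lambda>r. V r k) has_vector_derivative L (1, 0)) (at t within {a..b})"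
    unfolding has_vector_derivative_def by (metis (no_types, lifting) has_derivative_eq_rhs ext)
  then show ?thesis using t by (intro vector_derivative_within_closed_interval) auto
qed

lemma C1_on_gradient_slice:
  fixes V :: "real \<Rightarrow> 'a::euclidean_space \<Rightarrow> real"
  assumes "C2_on (A \<times> UNIV) (\<lambda>(t, k). V t k)"
  shows "C1_on (A \<times> UNIV) (\<lambda>(t, k). gradient (V t) k)"
proof -
  obtain V' where V': "\<forall>p\<in>A \<times> UNIV.
      ((\<lambda>(t, k). V t k) has_derivative blinfun_apply (V' p)) (at p within A \<times> UNIV)"
    and "C1_on (A \<times> UNIV) V'"
    using assms unfolding C2_on_def by blast
  define R where "R L = (\<Sum>b\<in>Basis. blinfun_apply L (0, b) *\<^sub>R b)"
    for L :: "(real \<times> 'a) \<Rightarrow>\<^sub>L real"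
  have "bounded_linear R"
    unfolding R_def
    by (rule bounded_linear_sum)
       (rule bounded_linear_compose[OF bounded_linear_scaleR_left blinfun.bounded_linear_left])
  then have "C1_on UNIV R" by (rule C1_on_bounded_linear)
  from C1_on_compose[OF this \<open>C1_on (A \<times> UNIV) V'\<close>]
  have "C1_on (A \<times> UNIV) (\<lambda>p. R (V' p))" by simp
  then show ?thesis
  proof (rule C1_on_cong)
    fix p assume "p \<in> A \<times> (UNIV :: 'a set)"
    then obtain t k where p: "p = (t, k)" "t \<in> A" by auto
    then have "((\<lambda>(t, k). V t k) has_derivative blinfun_apply (V' (t, k))) (at (t, k) within A \<times> UNIV)"
      using V' by auto
    from gradient_slice(1)[OF this p(2)]
    show "R (V' p) = (case p of (t, k) \<Rightarrow> gradient (V t) k)" by (simp add: p R_def)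
  qed
qed

section \<open>The equilibrium equations along the flow\<close>

text \<open>
  The data of the problem. Concavity of \<open>u\<close> and invertibility of its gradient enter only
  through the formula \<open>legendre\<close> for the Legendre-Fenchel transform.
\<close>

locale equilibrium_setting =
  fixes T :: real
    and h h' :: "real \<Rightarrow> real"
    and u g :: "'a::euclidean_space \<Rightarrow> real"
    and f :: "real \<Rightarrow> 'a \<Rightarrow> 'a"
    and i :: "'a \<Rightarrow> 'a"
    and V :: "real \<Rightarrow> 'a \<Rightarrow> real"
    and \<sigma> :: "real \<Rightarrow> 'a \<Rightarrow> 'a"
    and K :: "real \<Rightarrow> real \<Rightarrow> 'a \<Rightarrow> 'a"
  assumes T_pos: "T > 0"
    and h_deriv: "\<And>t. t \<ge> 0 \<Longrightarrow> (h has_real_derivative h' t) (at t within {0..})"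
    and h'_cont: "continuous_on {0..} h'"
    and h_0: "h 0 = 1"
    and u_cont: "continuous_on UNIV u"
    and g_cont: "continuous_on UNIV g"
    and f_C1: "C1_on ({0..T} \<times> UNIV) (\<lambda>(t, k). f t k)"
    and i_C1: "C1_on UNIV i"
    and legendre: "\<And>x. legendre_fenchel u x = u (i x) - inner x (i x)"
    and V_C2: "C2_on ({0..T} \<times> UNIV) (\<lambda>(t, k). V t k)"
    and sigma: "\<sigma> = (\<lambda>t k. i (gradient (V t) k))"
    and flow: "is_flow T (\<lambda>s k. f s k - \<sigma> s k) K"
begin

text \<open>Left-hand side minus right-hand side of the integrated equilibrium equation.\<close>

definition integrated_defect :: "real \<Rightarrow> 'a \<Rightarrow> real" where
  "integrated_defect t k = V t k
     - (integral {t..T} (\<lambda>s. h (s - t) * u (\<sigma> s (K s t k))) + h (T - t) * g (K T t k))"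

text \<open>
  Left-hand side of the differentiated equilibrium equation. The time derivative is relative to
  \<open>[0,T]\<close>, hence one-sided at the end points.
\<close>

definition differentiated_defect :: "real \<Rightarrow> 'a \<Rightarrow> real" where
  "differentiated_defect t k = vector_derivative (\<lambda>r. V r k) (at t within {0..T})
     + integral {t..T} (\<lambda>s. h' (s - t) * u (\<sigma> s (K s t k)))
     + h' (T - t) * g (K T t k)
     + legendre_fenchel u (gradient (V t) k)
     + inner (gradient (V t) k) (f t k)"

lemma gradient_V_C1: "C1_on ({0..T} \<times> UNIV) (\<lambda>(t, k). gradient (V t) k)"
  using V_C2 by (rule C1_on_gradient_slice)

lemma sigma_C1: "C1_on ({0..T} \<times> UNIV) (\<lambda>(t, k). \<sigma> t k)"
  using C1_on_compose[OF i_C1 gradient_V_C1] by (simp add: sigma case_prod_unfold)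

lemma velocity_C1: "C1_on ({0..T} \<times> UNIV) (\<lambda>(t, k). f t k - \<sigma> t k)"
  using C1_on_diff[OF f_C1 sigma_C1] by (simp add: case_prod_unfold)

lemma flow_has_derivative:
  assumes "0 \<le> t" "t \<le> s" "s \<le> T"
  shows "((\<lambda>s. K s t k) has_vector_derivative f s (K s t k) - \<sigma> s (K s t k)) (at s within {t..T})"
  using flow assms unfolding is_flow_def by auto

lemma flow_continuous_on:
  assumes "0 \<le> t"
  shows "continuous_on {t..T} (\<lambda>s. K s t k)"
  by (rule continuous_on_vector_derivative) (use flow_has_derivative assms in auto)

lemma flow_initial: "0 \<le> t \<Longrightarrow> t \<le> T \<Longrightarrow> K t t k = k"
  using flow unfolding is_flow_def by auto

lemma utility_continuous_on: "continuous_on ({0..T} \<times> UNIV) (\<lambda>(t, k). u (\<sigma> t k))"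
  using continuous_on_compose2[OF u_cont C1_on_imp_continuous_on[OF sigma_C1]]
  by (simp add: split_beta)

lemma utility_along_flow_continuous_on:
  assumes "0 \<le> t"
  shows "continuous_on {t..T} (\<lambda>s. u (\<sigma> s (K s t k)))"
proof -
  have "continuous_on {t..T} (\<lambda>s. (s, K s t k))"
    using flow_continuous_on[OF assms] by (intro continuous_intros)
  from continuous_on_compose2[OF utility_continuous_on this] show ?thesis
    using assms by fastforce
qed

text \<open>For \<open>t = T\<close> the interval \<open>[t,T]\<close> is a point and the statement is void.\<close>

lemma integrated_defect_has_derivative_along_flow:
  assumes t: "0 \<le> t" and r: "r \<in> {t..T}"
  shows "((\<lambda>r. integrated_defect r (K r t k)) has_real_derivative
    differentiated_defect r (K r t k)) (at r within {t..T})"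
proof -
  define x where "x s = K s t k" for s
  define w where "w s = u (\<sigma> s (x s))" for s
  obtain V' where V': "\<forall>p\<in>{0..T} \<times> UNIV.
      ((\<lambda>(t, k). V t k) has_derivative blinfun_apply (V' p)) (at p within {0..T} \<times> UNIV)"
    using V_C2 unfolding C2_on_def by blast
  let ?L = "blinfun_apply (V' (r, x r))" and ?F = "f r (x r) - \<sigma> r (x r)"
  have L: "((\<lambda>(t, k). V t k) has_derivative ?L) (at (r, x r) within {0..T} \<times> UNIV)"
    using V' r t by auto
  have dx: "(x has_vector_derivative ?F) (at r within {t..T})"
    unfolding x_def using flow_has_derivative t r by auto
  have semigroup: "K s q (x q) = x s" if "q \<in> {t..T}" "s \<in> {q..T}" for q s
    unfolding x_def using that t by (intro is_flow_semigroup[OF flow velocity_C1]) auto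
  have dV: "((\<lambda>r. V r (x r)) has_real_derivative ?L (1, ?F)) (at r within {t..T})"
  proof -
    have "((\<lambda>(t, k). V t k) has_derivative ?L) (at (r, x r) within (\<lambda>s. (s, x s)) ` {t..T})"
      using L by (rule has_derivative_subset) (use t in auto)
    moreover have "((\<lambda>s. (s, x s)) has_derivative (\<lambda>z. (z, z *\<^sub>R ?F))) (at r within {t..T})"
      using dx unfolding has_vector_derivative_def
      by (intro has_derivative_Pair has_derivative_ident)
    ultimately have "((\<lambda>r. V r (x r)) has_derivative (\<lambda>z. ?L (z, z *\<^sub>R ?F))) (at r within {t..T})"
      using has_derivative_in_compose[of "\<lambda>s. (s, x s)" "\<lambda>z. (z, z *\<^sub>R ?F)" r "{t..T}" "\<lambda>(t, k). V t k" ?L]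
      by simp
    moreover have "?L (z, z *\<^sub>R ?F) = ?L (1, ?F) * z" for z
      using blinfun.scaleR_right[of "V' (r, x r)" z "(1, ?F)"] by (simp add: mult.commute)
    ultimately show ?thesis
      unfolding has_field_derivative_def by (metis (no_types, lifting) has_derivative_eq_rhs ext)
  qed
  have dI: "((\<lambda>r. integral {r..T} (\<lambda>s. h (s - r) * w s)) has_real_derivative
      - (w r + integral {r..T} (\<lambda>s. h' (s - r) * w s))) (at r within {t..T})"
    using discounted_integral_has_derivative[OF h_deriv h'_cont _ r, of w]
      utility_along_flow_continuous_on[OF t] h_0 unfolding w_def x_def by simp
  have dh: "((\<lambda>r. h (T - r)) has_real_derivative - h' (T - r)) (at r within {t..T})"
  proof -
    have "(h has_real_derivative h' (T - r)) (at (T - r) within (\<lambda>r. T - r) ` {t..T})"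
      by (rule DERIV_subset[OF h_deriv]) (use r in auto)
    moreover have "((\<lambda>r. T - r) has_real_derivative -1) (at r within {t..T})"
      by (auto intro!: derivative_eq_intros)
    ultimately show ?thesis
      using DERIV_image_chain[of h "h' (T - r)" "\<lambda>r. T - r" r "{t..T}" "-1"]
      by (simp add: comp_def)
  qed
  have "((\<lambda>r. V r (x r) - (integral {r..T} (\<lambda>s. h (s - r) * w s) + h (T - r) * g (x T)))
      has_real_derivative ?L (1, ?F) - (- (w r + integral {r..T} (\<lambda>s. h' (s - r) * w s))
        + - h' (T - r) * g (x T))) (at r within {t..T})"
    by (intro DERIV_diff DERIV_add DERIV_cmult_right dV dI dh)
  moreover have "?L (1, ?F) - (- (w r + integral {r..T} (\<lambda>s. h' (s - r) * w s))
        + - h' (T - r) * g (x T)) = differentiated_defect r (x r)"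
  proof -
    have "?L (1, ?F) = ?L (1, 0) + ?L (0, ?F)"
      using blinfun.add_right[of "V' (r, x r)" "(1, 0)" "(0, ?F)"] by simp
    also have "?L (1, 0) = vector_derivative (\<lambda>q. V q (x r)) (at r within {0..T})"
      using time_derivative_slice[OF L] r t T_pos by auto
    also have "?L (0, ?F) = inner (gradient (V r) (x r)) ?F"
      using gradient_slice(2)[OF L] r t by auto
    finally have *: "?L (1, ?F) = vector_derivative (\<lambda>q. V q (x r)) (at r within {0..T})
        + inner (gradient (V r) (x r)) ?F" .
    have "integral {r..T} (\<lambda>s. h' (s - r) * u (\<sigma> s (K s r (x r))))
        = integral {r..T} (\<lambda>s. h' (s - r) * w s)"
      using semigroup[OF r] by (intro integral_cong) (simp add: w_def)
    moreover have "K T r (x r) = x T" using semigroup[OF r] r by auto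
    ultimately show ?thesis
      unfolding differentiated_defect_def * legendre
      by (simp add: w_def inner_diff_right sigma)
  qed
  moreover have "integrated_defect q (x q)
      = V q (x q) - (integral {q..T} (\<lambda>s. h (s - q) * w s) + h (T - q) * g (x T))"
    if q: "q \<in> {t..T}" for q
  proof -
    have "integral {q..T} (\<lambda>s. h (s - q) * u (\<sigma> s (K s q (x q))))
        = integral {q..T} (\<lambda>s. h (s - q) * w s)"
      using semigroup[OF q] by (intro integral_cong) (simp add: w_def)
    moreover have "K T q (x q) = x T" using semigroup[OF q] q by auto
    ultimately show ?thesis unfolding integrated_defect_def by simp
  qed
  ultimately have "((\<lambda>r. integrated_defect r (x r)) has_real_derivative
      differentiated_defect r (x r)) (at r within {t..T})"
    by (auto intro: has_field_derivative_transform_within[OF _ zero_less_one r])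
  then show ?thesis by (simp add: x_def)
qed

text \<open>
  Continuity of \<open>K T r k\<close> in \<open>r\<close> at \<open>r = T\<close> and boundedness of the integrand near \<open>T\<close> both come
  from the short-time estimate for the flow.
\<close>

lemma differentiated_defect_tendsto_terminal:
  "((\<lambda>r. differentiated_defect r k) \<longlongrightarrow> differentiated_defect T k) (at T within {0..T})"
proof -
  obtain V' where V': "\<forall>p\<in>{0..T} \<times> UNIV.
      ((\<lambda>(t, k). V t k) has_derivative blinfun_apply (V' p)) (at p within {0..T} \<times> UNIV)"
    and "C1_on ({0..T} \<times> UNIV) V'"
    using V_C2 unfolding C2_on_def by blast
  from C1_on_imp_continuous_on[OF this(2)]
  have cV': "continuous_on ({0..T} \<times> UNIV) V'" .
  have slice: "continuous_on {0..T} (\<lambda>r. G (r, k))"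
    if "continuous_on ({0..T} \<times> UNIV) G" for G :: "real \<times> 'a \<Rightarrow> 'b::topological_space"
    using that by (rule continuous_on_compose2) (auto intro!: continuous_intros)
  have grad: "continuous_on {0..T} (\<lambda>r. gradient (V r) k)"
    using slice[OF C1_on_imp_continuous_on[OF gradient_V_C1]] by simp
  have fk: "continuous_on {0..T} (\<lambda>r. f r k)"
    using slice[OF C1_on_imp_continuous_on[OF f_C1]] by simp
  have ik: "continuous_on {0..T} (\<lambda>r. i (gradient (V r) k))"
    using continuous_on_compose2[OF C1_on_imp_continuous_on[OF i_C1] grad] by simp
  have "continuous_on {0..T} (\<lambda>r. blinfun_apply (V' (r, k)) (1, 0))"
    by (intro blinfun.continuous_on slice cV' continuous_on_const)
  then have "continuous_on {0..T} (\<lambda>r. vector_derivative (\<lambda>q. V q k) (at r within {0..T}))"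
    by (rule continuous_on_eq) (use V' T_pos in \<open>auto intro!: time_derivative_slice[symmetric]\<close>)
  then have "continuous_on {0..T} (\<lambda>r. vector_derivative (\<lambda>q. V q k) (at r within {0..T})
      + legendre_fenchel u (gradient (V r) k) + inner (gradient (V r) k) (f r k))" (is "continuous_on _ ?A")
    unfolding legendre
    by (intro continuous_intros grad fk ik continuous_on_compose2[OF u_cont ik]) auto
  then have A: "(?A \<longlongrightarrow> ?A T) (at T within {0..T})"
    using T_pos by (simp add: continuous_on_def)
  have near: "eventually (\<lambda>r. r \<in> {0..T} \<and> T - r < \<delta>) (at T within {0..T})" if "\<delta> > 0" for \<delta>
    using that unfolding eventually_at by (intro exI[of _ \<delta>]) (auto simp: dist_real_def)
  note short = is_flow_short_time[OF flow C1_on_imp_continuous_on[OF velocity_C1], where k = k]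
  have "((\<lambda>r. K T r k) \<longlongrightarrow> k) (at T within {0..T})"
  proof (rule tendstoI)
    fix e :: real assume "e > 0"
    then obtain \<delta> where \<delta>: "\<delta> > 0"
      "\<And>r s. 0 \<le> r \<Longrightarrow> r \<le> s \<Longrightarrow> s \<le> T \<Longrightarrow> s - r < \<delta> \<Longrightarrow> dist (K s r k) k < e"
      by (rule short) (rule that; blast)
    show "eventually (\<lambda>r. dist (K T r k) k < e) (at T within {0..T})"
      using near[OF \<delta>(1)] by eventually_elim (auto intro: \<delta>(2))
  qed
  moreover have "(g \<longlongrightarrow> g k) (nhds k)"
    using g_cont by (simp add: continuous_on_eq_continuous_at isCont_def tendsto_at_iff_tendsto_nhds)
  ultimately have "((\<lambda>r. g (K T r k)) \<longlongrightarrow> g k) (at T within {0..T})"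
    by (rule filterlim_compose[rotated])
  moreover have "continuous_on {0..T} (\<lambda>r. h' (T - r))"
    by (rule continuous_on_compose2[OF h'_cont]) (auto intro!: continuous_intros)
  then have "((\<lambda>r. h' (T - r)) \<longlongrightarrow> h' (T - T)) (at T within {0..T})"
    unfolding continuous_on_def by (rule bspec) (use T_pos in simp)
  ultimately have B: "((\<lambda>r. h' (T - r) * g (K T r k)) \<longlongrightarrow> h' (T - T) * g (K T T k)) (at T within {0..T})"
    using T_pos by (simp add: flow_initial tendsto_mult)
  obtain \<delta> where \<delta>: "\<delta> > 0"
    "\<And>r s. 0 \<le> r \<Longrightarrow> r \<le> s \<Longrightarrow> s \<le> T \<Longrightarrow> s - r < \<delta> \<Longrightarrow> dist (K s r k) k < 1"
    by (rule short[OF zero_less_one]) (rule that; blast)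
  \<comment> \<open>The product of \<open>h'\<close> and the utility is bounded on a compact set that contains the paths
    starting in \<open>k\<close> after time \<open>T - \<delta>\<close>, so the integral is at most of the order of \<open>T - r\<close>.\<close>
  have "compact ((\<lambda>p. h' (fst p) * (case snd p of (t, k) \<Rightarrow> u (\<sigma> t k)))
      ` ({0..T} \<times> ({0..T} \<times> cball k 1)))"
    by (intro compact_continuous_image continuous_intros continuous_on_compose2[OF h'_cont]
        continuous_on_compose2[OF utility_continuous_on] compact_Times) auto
  from compact_imp_bounded[OF this]
  obtain M where "\<forall>z\<in>(\<lambda>p. h' (fst p) * (case snd p of (t, k) \<Rightarrow> u (\<sigma> t k)))
      ` ({0..T} \<times> ({0..T} \<times> cball k 1)). norm z \<le> M"
    unfolding bounded_iff ..
  then have M: "norm (h' a * u (\<sigma> q y)) \<le> M"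
    if "a \<in> {0..T}" "q \<in> {0..T}" "y \<in> cball k 1" for a q y
    using that by auto
  have "((\<lambda>r. integral {r..T} (\<lambda>s. h' (s - r) * u (\<sigma> s (K s r k)))) \<longlongrightarrow> 0) (at T within {0..T})"
  proof (rule Lim_null_comparison)
    show "((\<lambda>r. M * (T - r)) \<longlongrightarrow> 0) (at T within {0..T})"
      by (auto intro!: tendsto_eq_intros)
    show "eventually (\<lambda>r. norm (integral {r..T} (\<lambda>s. h' (s - r) * u (\<sigma> s (K s r k)))) \<le> M * (T - r))
        (at T within {0..T})"
      using near[OF \<delta>(1)]
    proof eventually_elim
      case (elim r)
      show ?case
      proof (rule integral_bound)
        show "r \<le> T" using elim by auto
        show "continuous_on {r..T} (\<lambda>s. h' (s - r) * u (\<sigma> s (K s r k)))"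
          using elim
          by (intro continuous_intros continuous_on_compose2[OF h'_cont]
              utility_along_flow_continuous_on) auto
        fix s assume s: "s \<in> {r..T}"
        then have "dist (K s r k) k < 1" using elim by (intro \<delta>(2)) auto
        then show "norm (h' (s - r) * u (\<sigma> s (K s r k))) \<le> M"
          using M[of "s - r" s "K s r k"] s elim by (auto simp: dist_commute)
      qed
    qed
  qed
  from tendsto_add[OF tendsto_add[OF A B] this] show ?thesis
    unfolding differentiated_defect_def by (simp add: ac_simps)
qed

theorem integrated_iff_differentiated:
  "(\<forall>t\<in>{0..T}. \<forall>k. integrated_defect t k = 0) \<longleftrightarrow>
   (\<forall>t\<in>{0..T}. \<forall>k. differentiated_defect t k = 0) \<and> (\<forall>k. V T k = g k)"
proof -
  have terminal: "integrated_defect T k = V T k - g k" for k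
    using T_pos by (simp add: integrated_defect_def h_0 flow_initial)
  show ?thesis
  proof (intro iffI conjI ballI allI)
    assume I: "\<forall>t\<in>{0..T}. \<forall>k. integrated_defect t k = 0"
    show "V T k = g k" for k using I T_pos terminal[of k] by auto
    have before: "differentiated_defect t k = 0" if t: "0 \<le> t" "t < T" for t k
    proof -
      have "((\<lambda>r. integrated_defect r (K r t k)) has_real_derivative differentiated_defect t k)
          (at t within {t..T})"
        using integrated_defect_has_derivative_along_flow[of t t k] t by (simp add: flow_initial)
      then have "((\<lambda>r. 0) has_real_derivative differentiated_defect t k) (at t within {t..T})"
        by (rule has_field_derivative_transform_within[OF _ zero_less_one]) (use I t in auto)
      then have "((\<lambda>r. 0) has_vector_derivative differentiated_defect t k) (at t within {t..T})"
        by (simp add: has_real_derivative_iff_has_vector_derivative)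
      then have "vector_derivative (\<lambda>r. 0) (at t within {t..T}) = differentiated_defect t k"
        using t by (intro vector_derivative_within_closed_interval) auto
      moreover have "vector_derivative (\<lambda>r. 0) (at t within {t..T}) = (0 :: real)"
        using t by (intro vector_derivative_within_closed_interval) auto
      ultimately show ?thesis by simp
    qed
    fix t k assume t: "t \<in> {0..T}"
    show "differentiated_defect t k = 0"
    proof (cases "t = T")
      case False
      then show ?thesis using before t by auto
    next
      case True
      have "eventually (\<lambda>r. differentiated_defect r k = 0) (at T within {0..T})"
        unfolding eventually_at using before by (intro exI[of _ 1]) auto
      then have "((\<lambda>r. differentiated_defect r k) \<longlongrightarrow> 0) (at T within {0..T})"
        by (rule tendsto_eventually)
      moreover have "at T within {0..T} \<noteq> bot"
        using T_pos by (simp add: trivial_limit_within islimpt_Icc)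
      ultimately show ?thesis
        using differentiated_defect_tendsto_terminal[of k] True by (auto dest: tendsto_unique)
    qed
  next
    assume D: "(\<forall>t\<in>{0..T}. \<forall>k. differentiated_defect t k = 0) \<and> (\<forall>k. V T k = g k)"
    fix t k assume t: "t \<in> {0..T}"
    have "integrated_defect t (K t t k) = integrated_defect T (K T t k)"
    proof (rule has_derivative_zero_unique[where s = "{t..T}" and x = t and y = T
          and f = "\<lambda>r. integrated_defect r (K r t k)"])
      fix r assume r: "r \<in> {t..T}"
      then have "differentiated_defect r (K r t k) = 0" using D t by auto
      with integrated_defect_has_derivative_along_flow[of t r k] r t
      show "((\<lambda>r. integrated_defect r (K r t k)) has_derivative (\<lambda>_. 0)) (at r within {t..T})"
        by (simp add: has_field_derivative_def mult_zero_left[abs_def])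
    qed (use t in auto)
    then show "integrated_defect t k = 0" using t D terminal by (simp add: flow_initial)
  qed
qed

end

theorem proposition3:
  fixes T :: real
    and h h' :: "real \<Rightarrow> real"
    and u g :: "real ^ 'n \<Rightarrow> real"
    and f :: "real \<Rightarrow> real ^ 'n \<Rightarrow> real ^ 'n"
    and i :: "real ^ 'n \<Rightarrow> real ^ 'n"
    and V :: "real \<Rightarrow> real ^ 'n \<Rightarrow> real"
    and \<sigma> :: "real \<Rightarrow> real ^ 'n \<Rightarrow> real ^ 'n"
    and K :: "real \<Rightarrow> real \<Rightarrow> real ^ 'n \<Rightarrow> real ^ 'n"
  assumes "T > 0"
    and h_deriv: "\<And>t. t \<ge> 0 \<Longrightarrow> (h has_real_derivative h' t) (at t within {0..})"
    and h'_cont: "continuous_on {0..} h'"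
    and h_0: "h 0 = 1"
    and h_nonneg: "\<And>t. t \<ge> 0 \<Longrightarrow> h t \<ge> 0"
    and h'_nonpos: "\<And>t. t \<ge> 0 \<Longrightarrow> h' t \<le> 0"
    and h_lim: "(h \<longlongrightarrow> 0) at_top"
    and u_C2: "C2_on UNIV u"
    and f_C2: "C2_on ({0..T} \<times> UNIV) (\<lambda>(t, k). f t k)"
    and g_C2: "C2_on UNIV g"
    and u_concave: "strictly_concave u"
    and f_concave: "\<And>t j. t \<in> {0..T} \<Longrightarrow> strictly_concave (\<lambda>k. f t k $ j)"
    and i_right: "\<And>x. gradient u (i x) = x"
    and i_left: "\<And>c. i (gradient u c) = c"
    and i_C1: "C1_on UNIV i"
    and V_C2: "C2_on ({0..T} \<times> UNIV) (\<lambda>(t, k). V t k)"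
    and sigma: "\<sigma> = (\<lambda>t k. i (gradient (V t) k))"
    and flow: "is_flow T (\<lambda>s k. f s k - \<sigma> s k) K"
  shows
    "(\<forall>t\<in>{0..T}. \<forall>k.
        V t k = integral {t..T} (\<lambda>s. h (s - t) * u (\<sigma> s (K s t k))) + h (T - t) * g (K T t k))
     \<longleftrightarrow>
     (\<forall>t\<in>{0..T}. \<forall>k.
        vector_derivative (\<lambda>r. V r k) (at t within {0..T})
        + integral {t..T} (\<lambda>s. h' (s - t) * u (\<sigma> s (K s t k)))
        + h' (T - t) * g (K T t k)
        + legendre_fenchel u (gradient (V t) k)
        + inner (gradient (V t) k) (f t k) = 0)
     \<and> (\<forall>k. V T k = g k)"
proof -
  have u_deriv: "\<exists>L. (u has_derivative L) (at c)" for c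
    using u_C2 unfolding C2_on_def by auto
  interpret equilibrium_setting T h h' u g f i V \<sigma> K
  proof
    show "T > 0" "continuous_on {0..} h'" "h 0 = 1" by fact+
    show "(h has_real_derivative h' t) (at t within {0..})" if "t \<ge> 0" for t
      using that by (rule h_deriv)
    show "continuous_on UNIV u" "continuous_on UNIV g"
      using u_C2 g_C2 by (auto intro: C1_on_imp_continuous_on C2_on_imp_C1_on)
    show "C1_on ({0..T} \<times> UNIV) (\<lambda>(t, k). f t k)" using f_C2 by (rule C2_on_imp_C1_on)
    show "legendre_fenchel u x = u (i x) - inner x (i x)" for x
      using u_deriv[of "i x"] legendre_fenchel_eq[OF u_concave, of _ "i x"] i_right[of x] by auto
  qed fact+
  show ?thesis
    using integrated_iff_differentiated
    unfolding integrated_defect_def differentiated_defect_def by simp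
qed

end
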